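(* Define $\kappa_2(t)$ for integers $t\ge1$ by $\kappa_2(1)=2$, $\kappa_2(2t)=\kappa_2(t)$, and $\kappa_2(2t+1)=\frac{\kappa_2(t)+\kappa_2(t+1)}{2}+1$. There exist constants $M_0$ and $C$ such that for every positive integer $t$ whose binary expansion has $M>M_0$ maximal blocks of $1$s, and for all integers $j$, \[\left|\delta(j,t)-\frac{1}{\sqrt{2\pi\kappa_2(t)}}\exp\left(-\frac{j^2}{2\kappa_2(t)}\right)\right|\le C\,M^{-1}(\log M)^4.\]
   Context: $s(n)$ denotes the number of $1$s in the binary expansion of the nonnegative integer $n$. For integers $j$ and $t\ge0$, $\delta(j,t)=\lim_{N\to\infty}\frac1N\bigl|\{0\le n<N: s(n+t)-s(n)=j\}\bigr|$ (this limit exists). A maximal block of $1$s in the binary expansion of $t$ is a maximal run of consecutive binary digits equal to $1$. *)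

theory Defs
  imports Complex_Main
begin

fun bin_digit_sum :: "nat \<Rightarrow> nat" where
  "bin_digit_sum n = (if n = 0 then 0 else n mod 2 + bin_digit_sum (n div 2))"

text \<open>delta(j,t): asymptotic density of n with s(n+t) - s(n) = j (the limit exists).\<close>
definition delta :: "int \<Rightarrow> nat \<Rightarrow> real" where
  "delta j t = lim (\<lambda>N. real (card {n. n < N \<and>
      int (bin_digit_sum (n + t)) - int (bin_digit_sum n) = j}) / real N)"

text \<open>kappa_2(t) for t >= 1: kappa_2(1) = 2, kappa_2(2t) = kappa_2(t),
  kappa_2(2t+1) = (kappa_2(t) + kappa_2(t+1))/2 + 1. The value at 0 is irrelevant.\<close>
function kappa2 :: "nat \<Rightarrow> real" where
  "kappa2 n = (if n \<le> 1 then 2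
     else if even n then kappa2 (n div 2)
     else (kappa2 (n div 2) + kappa2 (n div 2 + 1)) / 2 + 1)"
  by auto
termination
  by (relation "measure id") (auto, presburger+)

text \<open>Number of maximal blocks of 1s in the binary expansion of t: each block is
  counted via its most significant position i (bit i = 1 and bit i+1 = 0).\<close>
definition num_blocks :: "nat \<Rightarrow> nat" where
  "num_blocks t = card {i. odd (t div 2 ^ i) \<and> even (t div 2 ^ (i + 1))}"

end

theory Submission
  imports Defs "HOL-Probability.Probability"
begin

text \<open>
Let \<open>\<gamma>\<^sub>t(\<theta>) = \<Sum>j. \<delta>(j,t) e\<^bsup>ij\<theta>\<^esup>\<close>. Splitting \<open>n\<close> by parity gives \<open>\<gamma>\<^sub>2\<^sub>t = \<gamma>\<^sub>t\<close> and
\<open>\<gamma>\<^sub>2\<^sub>t\<^sub>+\<^sub>1 = (e\<^bsup>i\<theta>\<^esup> \<gamma>\<^sub>t + e\<^bsup>-i\<theta>\<^esup> \<gamma>\<^sub>t\<^sub>+\<^sub>1)/2\<close>. Two consequences of this recurrence suffice.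

\<^item> The distance between \<open>\<gamma>\<^sub>t(\<theta>)\<close> and \<open>exp(-\<kappa>\<^sub>2(t)\<theta>\<^sup>2/2)\<close> obeys the recurrence of \<open>\<kappa>\<^sub>2\<close> itself, up to a
  factor \<open>O(|\<theta>|\<^sup>3)\<close>; hence it is \<open>O(\<kappa>\<^sub>2(t)|\<theta>|\<^sup>3)\<close>, and \<open>M \<le> \<kappa>\<^sub>2(t) \<le> 4M\<close>.

\<^item> Appending two binary digits to \<open>t\<close> produces a cancellation of phases, which yields
  \<open>|\<gamma>\<^sub>t(\<theta>)| \<le> exp(-M\<theta>\<^sup>2/96)\<close> for \<open>|\<theta>| \<le> \<pi>\<close>.

Fourier inversion, using the first bound for \<open>|\<theta>| \<le> (log M)/\<surd>M\<close> and the second one beyond,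
gives the error \<open>O(M\<theta>\<^sup>4) = O((log M)\<^sup>4/M)\<close> at the cut-off.
\<close>

subsection \<open>Digit recurrences\<close>

declare bin_digit_sum.simps [simp del] kappa2.simps [simp del]

lemma bin_digit_sum_double: "bin_digit_sum (2 * n) = bin_digit_sum n"
  by (subst bin_digit_sum.simps) (simp add: bin_digit_sum.simps[of 0])

lemma bin_digit_sum_double_Suc: "bin_digit_sum (Suc (2 * n)) = Suc (bin_digit_sum n)"
  by (subst bin_digit_sum.simps) simp

text \<open>Carries only turn 1s into 0s. This rules out jumps j \<ge> 2 for t = 1, which is where
  the downward induction on j for the density at t = 1 starts.\<close>

lemma bin_digit_sum_Suc_le: "bin_digit_sum (Suc n) \<le> Suc (bin_digit_sum n)"
proof (induction n rule: less_induct)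
  case (less n)
  show ?case
  proof (cases "even n")
    case True
    then obtain m where "n = 2 * m" by (auto elim: evenE)
    then show ?thesis by (simp add: bin_digit_sum_double bin_digit_sum_double_Suc)
  next
    case False
    then obtain m where m: "n = Suc (2 * m)" by (auto elim: oddE)
    then have "Suc n = 2 * Suc m" by simp
    then have "bin_digit_sum (Suc n) = bin_digit_sum (Suc m)"
      by (simp only: bin_digit_sum_double)
    then show ?thesis using less[of m] m by (simp add: bin_digit_sum_double_Suc)
  qed
qed

section \<open>Recurrences for \<open>kappa2\<close> and for the number of blocks, and their
  comparison\<close>

lemma kappa2_double: "t > 0 \<Longrightarrow> kappa2 (2 * t) = kappa2 t"
  by (subst kappa2.simps) simp

lemma kappa2_double_Suc:
  "t > 0 \<Longrightarrow> kappa2 (Suc (2 * t)) = (kappa2 t + kappa2 (Suc t)) / 2 + 1"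
  by (subst kappa2.simps) simp

lemma kappa2_double_Suc_Suc: "kappa2 (Suc (Suc (2 * t))) = kappa2 (Suc t)"
  using kappa2_double[of "Suc t"] by simp

lemma kappa2_1 [simp]: "kappa2 (Suc 0) = 2"
  by (subst kappa2.simps) simp

lemma num_blocks_0 [simp]: "num_blocks 0 = 0"
  by (simp add: num_blocks_def)

lemma finite_block_positions:
  fixes t :: nat
  shows "finite {i. odd (t div 2 ^ i) \<and> even (t div 2 ^ (i + 1))}"
proof (rule finite_subset)
  show "{i. odd (t div 2 ^ i) \<and> even (t div 2 ^ (i + 1))} \<subseteq> {..<t}"
  proof safe
    fix i assume "odd (t div 2 ^ i)"
    then have "2 ^ i \<le> t" by (metis div_less even_zero not_le)
    then show "i < t" by (meson less_exp less_le_trans)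
  qed
qed simp

text \<open>Halving t shifts every counted position down by one. Only position 0 is lost, and it is
  counted exactly when the last digit is a 1 and the next higher one a 0.\<close>

lemma num_blocks_div_2:
  "num_blocks t = num_blocks (t div 2) + (if odd t \<and> even (t div 2) then 1 else 0)"
proof -
  let ?S = "\<lambda>t. {i. odd (t div 2 ^ i) \<and> even (t div 2 ^ (i + 1))} :: nat set"
  have eq: "?S t = (if odd t \<and> even (t div 2) then {0} else {}) \<union> Suc ` ?S (t div 2)"
    (is "?L = ?R")
  proof (rule set_eqI)
    fix i show "i \<in> ?L \<longleftrightarrow> i \<in> ?R"
      by (cases i) (auto simp: div_mult2_eq image_iff)
  qed
  show ?thesis
    unfolding num_blocks_def eq
    by (subst card_Un_disjoint)
       (auto simp: card_image simp del: power_Suc intro: finite_block_positions[simplified])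
qed

lemma num_blocks_double: "num_blocks (2 * t) = num_blocks t"
  by (subst num_blocks_div_2) simp

lemma num_blocks_double_Suc:
  "num_blocks (Suc (2 * t)) = num_blocks t + (if even t then 1 else 0)"
  by (subst num_blocks_div_2) simp

text \<open>Induction by appending a binary digit. The pair (t, t + 1) determines both (2t, 2t + 1)
  and (2t + 1, 2t + 2), so it is applied below to joint statements about t and
  \<open>Suc t\<close>.\<close>

lemma binary_induct [case_names zero double double_Suc]:
  fixes P :: "nat \<Rightarrow> bool"
  assumes "P 0" and "\<And>t. t > 0 \<Longrightarrow> P t \<Longrightarrow> P (2 * t)" and "\<And>t. P t \<Longrightarrow> P (Suc (2 * t))"
  shows "P t"
proof (induction t rule: less_induct)
  case (less t)
  consider "t = 0" | m where "t = 2 * m" "m > 0" | m where "t = Suc (2 * m)"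
    by (metis gr0I mult_0_right odd_two_times_div_two_nat evenE oddE Suc_eq_plus1)
  then show ?case using less assms by cases auto
qed

lemma kappa2_estimates:
  assumes "t > 0"
  shows "\<bar>kappa2 t - kappa2 (Suc t)\<bar> \<le> 2"
    and "kappa2 t \<ge> num_blocks t"
    and "kappa2 t \<le> 4 * num_blocks t"
proof -
  \<comment> \<open>The bounds for \<open>Suc t\<close> are measured in blocks of t. In the upper
    bound the offset -2 for odd t exactly absorbs the +1 of the recurrence when a 1 prolongs a
    block, and the offset +2 for even t fits into the 4 granted to a new block. The gap 2 is the
    fixed point of x/2 + 1.\<close>
  have "t > 0 \<longrightarrow> \<bar>kappa2 t - kappa2 (Suc t)\<bar> \<le> 2 \<and>
    kappa2 t \<ge> num_blocks t \<and> kappa2 (Suc t) \<ge> num_blocks t + (if even t then 1 else 0) \<and>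
    kappa2 t \<le> 4 * num_blocks t \<and>
    kappa2 (Suc t) \<le> 4 * num_blocks t + (if even t then 2 else - 2)"
  proof (induction t rule: binary_induct)
    case (double t)
    then show ?case
      by (auto simp: kappa2_double kappa2_double_Suc num_blocks_double abs_le_iff split: if_splits;
          simp add: field_simps)
  next
    case (double_Suc t)
    show ?case
    proof (cases "t = 0")
      case True
      then show ?thesis
        using kappa2_double[of 1] num_blocks_double_Suc[of 0] by (simp add: numeral_2_eq_2)
    next
      case False
      then show ?thesis
        using double_Suc
        by (auto simp: kappa2_double_Suc_Suc kappa2_double_Suc num_blocks_double_Suc abs_le_iff
            split: if_splits; simp add: field_simps)
    qed
  qed simp
  then show "\<bar>kappa2 t - kappa2 (Suc t)\<bar> \<le> 2" "kappa2 t \<ge> num_blocks t"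
    "kappa2 t \<le> 4 * num_blocks t"
    using assms by auto
qed

subsection \<open>Decay of the characteristic function\<close>

text \<open>
The characteristic function of \<open>\<delta>(\<cdot>,t)\<close>. Its value at \<open>t = 1\<close> solves the recurrence for odd
arguments with \<open>t = 0\<close>, in which \<open>char_fun 1\<close> occurs on both sides.
\<close>
function char_fun :: "nat \<Rightarrow> real \<Rightarrow> complex" where
  "char_fun t \<theta> =
    (if t = 0 then 1
     else if t = 1 then cis \<theta> / (2 - cis (- \<theta>))
     else if even t then char_fun (t div 2) \<theta>
     else cis \<theta> / 2 * char_fun (t div 2) \<theta> + cis (- \<theta>) / 2 * char_fun (t div 2 + 1) \<theta>)"
  by auto
termination
  by (relation "Wellfounded.measure fst") (auto, presburger+)

declare char_fun.simps [simp del]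

lemma char_fun_0 [simp]: "char_fun 0 \<theta> = 1"
  by (simp add: char_fun.simps)

lemma two_minus_cis_nonzero: "2 - cis \<theta> \<noteq> 0"
proof
  assume "2 - cis \<theta> = 0"
  then have "norm (cis \<theta>) = norm (2 :: complex)" by simp
  then show False by simp
qed

lemma char_fun_double: "char_fun (2 * t) \<theta> = char_fun t \<theta>"
  by (cases "t = 0") (simp_all add: char_fun.simps[of "2 * t"])

lemma char_fun_double_Suc_Suc: "char_fun (Suc (Suc (2 * t))) \<theta> = char_fun (Suc t) \<theta>"
  using char_fun_double[of "Suc t"] by simp

lemma char_fun_double_Suc:
  "char_fun (Suc (2 * t)) \<theta> =
    cis \<theta> / 2 * char_fun t \<theta> + cis (- \<theta>) / 2 * char_fun (Suc t) \<theta>"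
proof (cases "t = 0")
  case True
  have "char_fun (Suc 0) \<theta> * (2 - cis (- \<theta>)) = cis \<theta>"
    using two_minus_cis_nonzero[of "- \<theta>"] by (simp add: char_fun.simps[of "Suc 0"])
  then show ?thesis
    unfolding True by (simp add: field_simps)
next
  case False
  then show ?thesis by (simp add: char_fun.simps[of "Suc (2 * t)"])
qed

lemma continuous_on_char_fun: "continuous_on UNIV (char_fun t)"
proof -
  have "continuous_on UNIV (char_fun t) \<and> continuous_on UNIV (char_fun (Suc t))"
  proof (induction t rule: binary_induct)
    case zero
    have "continuous_on UNIV (\<lambda>\<theta>. cis \<theta> / (2 - cis (- \<theta>)))"
      by (intro continuous_intros) (use two_minus_cis_nonzero in auto)
    then show ?case
      by (simp add: char_fun.simps[of "Suc 0", abs_def] char_fun.simps[of 0, abs_def])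
  next
    case (double t)
    then show ?case
      unfolding char_fun_double[abs_def] char_fun_double_Suc[abs_def]
      by (auto intro!: continuous_intros)
  next
    case (double_Suc t)
    then show ?case
      unfolding char_fun_double_Suc_Suc[abs_def] char_fun_double_Suc[abs_def]
      by (auto intro!: continuous_intros)
  qed
  then show ?thesis ..
qed

section \<open>Contraction of the modulus by appended digits\<close>

lemma norm_char_fun_double_Suc_le:
  "norm (char_fun (Suc (2 * t)) \<theta>) \<le> (norm (char_fun t \<theta>) + norm (char_fun (Suc t) \<theta>)) / 2"
  unfolding char_fun_double_Suc
  by (rule norm_triangle_le) (simp add: norm_mult norm_divide)

text \<open>With c = cos \<theta> the squared modulus is 5/16 + c/4. Its square root is concave in
  c, and the right-hand side is the tangent at c = 1.\<close>

lemma norm_half_cis_plus_quarter: "norm (cis \<theta> / 2 + 1 / 4) \<le> 7 / 12 + cos \<theta> / 6"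
proof (rule power2_le_imp_le)
  have "(norm (cis \<theta> / 2 + 1 / 4))\<^sup>2 = (cos \<theta> / 2 + 1 / 4)\<^sup>2 + (sin \<theta> / 2)\<^sup>2"
    by (simp add: cmod_power2)
  also have "\<dots> = 5 / 16 + cos \<theta> / 4"
    by (simp add: sin_squared_eq power2_sum power_divide field_simps)
  also have "\<dots> \<le> (7 / 12 + cos \<theta> / 6)\<^sup>2"
    using zero_le_power2[of "1 - cos \<theta>"] by (simp add: power2_eq_square field_simps)
  finally show "(norm (cis \<theta> / 2 + 1 / 4))\<^sup>2 \<le> (7 / 12 + cos \<theta> / 6)\<^sup>2" .
  show "0 \<le> 7 / 12 + cos \<theta> / 6"
    using cos_ge_minus_one[of \<theta>] by linarith
qed

lemma one_minus_cos_ge: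
  assumes "\<bar>\<theta>\<bar> \<le> pi"
  shows "1 - cos \<theta> \<ge> \<theta>\<^sup>2 / 8"
proof -
  define x where "x = \<theta> / 2"
  have "\<bar>x\<bar> \<le> pi / 2" using assms by (simp add: x_def)
  \<comment> \<open>1.6 exceeds pi/2 and 1.6^2 = 2.56 < 3, so the relative error x^2/6 of sin x
    against x is at most 1/2.\<close>
  then have "\<bar>x\<bar> < 1.6" using pi_approx by simp
  then have "\<bar>x\<bar>\<^sup>2 \<le> 1.6\<^sup>2" by (intro power_mono) auto
  then have x2: "x\<^sup>2 \<le> 3" by (simp add: power2_eq_square)
  have "\<bar>sin x - (\<Sum>m<3. sin_coeff m * x ^ m)\<bar> \<le> inverse (fact 3) * \<bar>x\<bar> ^ 3"
    by (rule Maclaurin_sin_bound)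
  then have "\<bar>sin x - x\<bar> \<le> \<bar>x\<bar> * (x\<^sup>2 / 6)"
    by (simp add: sin_coeff_def numeral_3_eq_3 fact_numeral power2_eq_square abs_mult)
  also have "\<dots> \<le> \<bar>x\<bar> * (1 / 2)" using x2 by (intro mult_left_mono) auto
  finally have "\<bar>x\<bar> / 2 \<le> \<bar>sin x\<bar>" by linarith
  then have "(\<bar>x\<bar> / 2)\<^sup>2 \<le> \<bar>sin x\<bar>\<^sup>2" by (intro power_mono) auto
  moreover have "1 - cos \<theta> = 2 * (sin x)\<^sup>2"
    using cos_double_sin[of x] by (simp add: x_def)
  ultimately show ?thesis by (simp add: x_def power2_eq_square)
qed

text \<open>Two routes lead from 4t + 1 back to t, with weights of modulus 1/2 and 1/4 and phases
  differing by \<theta>; keeping them together instead of applying the triangle inequality saves a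
  factor below 1. For 4t + 3 the same happens at t + 1 with conjugate phases.\<close>

lemma norm_char_fun_two_digits:
  assumes "\<bar>\<theta>\<bar> \<le> pi" "norm (char_fun t \<theta>) \<le> B" "norm (char_fun (Suc t) \<theta>) \<le> B"
  shows "norm (char_fun (Suc (2 * (2 * t))) \<theta>) \<le> exp (- \<theta>\<^sup>2 / 48) * B"
    and "norm (char_fun (Suc (2 * Suc (2 * t))) \<theta>) \<le> exp (- \<theta>\<^sup>2 / 48) * B"
proof -
  define \<rho> where "\<rho> = norm (cis \<theta> / 2 + 1 / 4) + 1 / 4"
  have "cis (- \<theta>) / 2 + 1 / 4 = cnj (cis \<theta> / 2 + 1 / 4)"
    by (simp add: cis_cnj)
  then have cnj: "norm (cis (- \<theta>) / 2 + 1 / 4) = norm (cis \<theta> / 2 + 1 / 4)"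
    by (simp only: complex_mod_cnj)
  \<comment> \<open>The first estimate gives \<rho> \<le> 1 - (1 - cos \<theta>)/6, the second one
    the remaining 8 in 48 = 6 * 8.\<close>
  have "\<rho> \<le> 1 - \<theta>\<^sup>2 / 48"
    using norm_half_cis_plus_quarter[of \<theta>] one_minus_cos_ge[OF assms(1)]
    unfolding \<rho>_def by linarith
  also have "\<dots> \<le> exp (- \<theta>\<^sup>2 / 48)" using exp_ge_add_one_self[of "- \<theta>\<^sup>2 / 48"] by simp
  finally have \<rho>: "\<rho> \<le> exp (- \<theta>\<^sup>2 / 48)" .
  have B: "B \<ge> 0" using assms(2) norm_ge_zero order_trans by blast
  have comb: "norm (a * z + b * w) \<le> exp (- \<theta>\<^sup>2 / 48) * B"
    if "norm a + norm b \<le> \<rho>" "norm z \<le> B" "norm w \<le> B" for a b z w :: complex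
  proof -
    have "norm (a * z + b * w) \<le> norm a * norm z + norm b * norm w"
      by (metis norm_mult norm_triangle_ineq)
    also have "\<dots> \<le> norm a * B + norm b * B"
      using that by (intro add_mono mult_left_mono) auto
    also have "\<dots> = (norm a + norm b) * B" by (simp add: algebra_simps)
    also have "\<dots> \<le> exp (- \<theta>\<^sup>2 / 48) * B"
      using that \<rho> B by (intro mult_right_mono) auto
    finally show ?thesis .
  qed
  have cc: "cis (- \<theta>) * cis \<theta> = 1" "cis \<theta> * cis (- \<theta>) = 1" by (simp_all add: cis_mult)
  have "char_fun (Suc (2 * (2 * t))) \<theta> =
      (cis \<theta> / 2 + (cis (- \<theta>) * cis \<theta>) / 4) * char_fun t \<theta>
      + (cis (- \<theta>) * cis (- \<theta>) / 4) * char_fun (Suc t) \<theta>"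
    unfolding char_fun_double_Suc char_fun_double by (simp add: algebra_simps)
  also have "norm \<dots> \<le> exp (- \<theta>\<^sup>2 / 48) * B"
    unfolding cc by (rule comb) (use assms in \<open>simp_all add: \<rho>_def norm_mult norm_divide\<close>)
  finally show "norm (char_fun (Suc (2 * (2 * t))) \<theta>) \<le> exp (- \<theta>\<^sup>2 / 48) * B" .
  have "char_fun (Suc (2 * Suc (2 * t))) \<theta> =
      (cis \<theta> * cis \<theta> / 4) * char_fun t \<theta>
      + (cis (- \<theta>) / 2 + (cis \<theta> * cis (- \<theta>)) / 4) * char_fun (Suc t) \<theta>"
    unfolding char_fun_double_Suc char_fun_double_Suc_Suc by (simp add: algebra_simps)
  also have "norm \<dots> \<le> exp (- \<theta>\<^sup>2 / 48) * B"
    unfolding cc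
    by (rule comb) (use assms cnj in \<open>simp_all add: \<rho>_def norm_mult norm_divide\<close>)
  finally show "norm (char_fun (Suc (2 * Suc (2 * t))) \<theta>) \<le> exp (- \<theta>\<^sup>2 / 48) * B" .
qed

lemma norm_char_fun_le_1:
  "norm (char_fun t \<theta>) \<le> 1"
proof -
  have "norm (char_fun t \<theta>) \<le> 1 \<and> norm (char_fun (Suc t) \<theta>) \<le> 1"
  proof (induction t rule: binary_induct)
    case zero
    \<comment> \<open>At t = 0 the averaged bound reads x \<le> (1 + x)/2, hence x \<le> 1.\<close>
    show ?case using norm_char_fun_double_Suc_le[of 0 \<theta>] by simp
  next
    case (double t)
    then show ?case using norm_char_fun_double_Suc_le[of t \<theta>] by (simp add: char_fun_double)
  next
    case (double_Suc t)
    then show ?case using norm_char_fun_double_Suc_le[of t \<theta>]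
      unfolding char_fun_double_Suc_Suc by simp
  qed
  then show ?thesis ..
qed

text \<open>
A block gains only the square root of the two-digit contraction factor, because consecutive blocks
separated by a single 0 share digits. The bounds for \<open>t + 1\<close> and \<open>2 t + 1\<close> are what makes the
induction on the digits close.
\<close>
lemma norm_char_fun_le:
  assumes "\<bar>\<theta>\<bar> \<le> pi"
  shows "norm (char_fun t \<theta>) \<le> exp (- \<theta>\<^sup>2 / 96) ^ num_blocks t"
proof -
  define r where "r = exp (- \<theta>\<^sup>2 / 96)"
  have r: "0 \<le> r" "r \<le> 1" by (simp_all add: r_def)
  have r2: "exp (- \<theta>\<^sup>2 / 48) = r * r" by (simp add: r_def flip: exp_add)
  note two_digits = norm_char_fun_two_digits[OF assms, unfolded r2]
  have "norm (char_fun t \<theta>) \<le> r ^ num_blocks t \<and>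
    norm (char_fun (Suc t) \<theta>) \<le> r ^ (num_blocks t - (if odd t then 1 else 0)) \<and>
    norm (char_fun (Suc (2 * t)) \<theta>) \<le> r ^ Suc (num_blocks t) \<and> (odd t \<longrightarrow> num_blocks t > 0)"
  proof (induction t rule: binary_induct)
    case zero
    have "norm (char_fun 1 \<theta>) \<le> r * r"
      using two_digits(1)[of 0 1] norm_char_fun_le_1[of 1 \<theta>] by simp
    also have "\<dots> \<le> r" using r by (simp add: mult_left_le)
    finally show ?case using r by simp
  next
    case (double t)
    let ?M = "num_blocks t" and ?k = "num_blocks t - (if odd t then 1 else 0)"
    have 1: "r ^ ?M \<le> r ^ ?k" using r by (intro power_decreasing) auto
    have "norm (char_fun (Suc (2 * (2 * t))) \<theta>) \<le> r * r * r ^ ?k"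
      using double 1 by (intro two_digits(1)) auto
    \<comment> \<open>For odd t the exponent \<open>?k\<close> is one short of the number of blocks.
      One of the two factors r repairs this, the other pays for the new block.\<close>
    also have "\<dots> = r ^ (2 + ?k)" by simp
    also have "\<dots> \<le> r ^ Suc ?M" using r by (intro power_decreasing) auto
    finally have 2: "norm (char_fun (Suc (2 * (2 * t))) \<theta>) \<le> r ^ Suc ?M" .
    have "r ^ Suc ?M \<le> r ^ ?M" using r by (intro power_decreasing) auto
    then show ?case using double 2 by (simp add: char_fun_double num_blocks_double)
  next
    case (double_Suc t)
    let ?M = "num_blocks t" and ?k = "num_blocks t - (if odd t then 1 else 0)"
    have 1: "r ^ ?M \<le> r ^ ?k" using r by (intro power_decreasing) auto
    have "norm (char_fun (Suc (2 * Suc (2 * t))) \<theta>) \<le> r * r * r ^ ?k"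
      using double_Suc 1 by (intro two_digits(2)) auto
    also have "\<dots> = r ^ (2 + ?k)" by simp
    \<comment> \<open>An even t gains a block and has no loss in \<open>?k\<close>; an odd t gains
      none and loses one. The subtraction is not truncated because an odd t has a block.\<close>
    also have "2 + ?k = Suc (num_blocks (Suc (2 * t)))"
      using double_Suc by (auto simp: num_blocks_double_Suc)
    finally have 2: "norm (char_fun (Suc (2 * Suc (2 * t))) \<theta>) \<le> r ^ Suc (num_blocks (Suc (2 * t)))" .
    have 3: "r ^ Suc ?M \<le> r ^ num_blocks (Suc (2 * t))"
      using r by (intro power_decreasing) (auto simp: num_blocks_double_Suc)
    have 4: "num_blocks (Suc (2 * t)) - 1 = ?k" "num_blocks (Suc (2 * t)) > 0"
      using double_Suc by (auto simp: num_blocks_double_Suc)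
    show ?case
      using double_Suc 2 3 4 unfolding char_fun_double_Suc_Suc by simp
  qed
  then show ?thesis by (simp add: r_def)
qed

subsection \<open>Gaussian approximation near the origin\<close>

lemma abs_cos_minus_quadratic_le:
  fixes x :: real
  shows "\<bar>cos x - (1 - x\<^sup>2 / 2)\<bar> \<le> \<bar>x\<bar> ^ 3"
proof -
  obtain s where "cos x = (\<Sum>m<3. cos_coeff m * x ^ m) + (cos (s + 1/2 * real 3 * pi) / fact 3) * x ^ 3"
    using Maclaurin_cos_expansion[of x 3] by blast
  then have "cos x - (1 - x\<^sup>2 / 2) = cos (s + 1/2 * real 3 * pi) / 6 * x ^ 3"
    by (simp add: cos_coeff_def numeral_3_eq_3 fact_numeral power2_eq_square)
  then have "\<bar>cos x - (1 - x\<^sup>2 / 2)\<bar> = \<bar>cos (s + 1/2 * real 3 * pi) / 6 * x ^ 3\<bar>"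
    by (rule arg_cong)
  also have "\<dots> = \<bar>cos (s + 1/2 * real 3 * pi)\<bar> / 6 * \<bar>x\<bar> ^ 3"
    by (simp add: abs_mult power_abs)
  also have "\<dots> \<le> 1 * \<bar>x\<bar> ^ 3"
    using abs_cos_le_one[of "s + 1/2 * real 3 * pi"] by (intro mult_right_mono) (auto simp del: abs_cos_le_one)
  finally show ?thesis by simp
qed

lemma abs_exp_minus_linear_le:
  fixes x :: real
  assumes "\<bar>x\<bar> \<le> 1 / 2"
  shows "\<bar>exp x - (1 + x)\<bar> \<le> x\<^sup>2"
proof -
  have "exp x \<le> 1 + x + x\<^sup>2"
  proof (cases "x \<ge> 0")
    case True
    then show ?thesis using assms by (intro exp_bound) auto
  next
    case False
    have "exp x \<le> 1 / (1 - x)"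
      using False exp_ge_add_one_self[of "- x"] by (simp add: exp_minus field_simps)
    \<comment> \<open>This amounts to 1 \<le> (1 - x)(1 + x + x^2) = 1 - x^3.\<close>
    also have "\<dots> \<le> 1 + x + x\<^sup>2"
      using False zero_le_power2[of x] mult_nonpos_nonneg[of x "x\<^sup>2"]
      by (simp add: field_simps power2_eq_square)
    finally show ?thesis .
  qed
  then show ?thesis using exp_ge_add_one_self[of x] by linarith
qed

text \<open>Averaging Gaussians of variances a and b, shifted by 1 and -1, matches a Gaussian of
  variance (a + b)/2 + 1 to second order; the +1 is the variance of the shift. As |a - b| \<le> 2,
  the mismatch p of the exponents is O(\<theta>^2), and it enters only through its square and
  through its product with sin \<theta>.\<close>

lemma cis_mixture_approx:
  fixes a b \<theta> :: real
  assumes \<theta>: "\<bar>\<theta>\<bar> \<le> 1" and ab: "\<bar>a - b\<bar> \<le> 2" "a + b \<ge> 0"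
  shows "norm (cis \<theta> / 2 * exp (- a * \<theta>\<^sup>2 / 2) + cis (- \<theta>) / 2 * exp (- b * \<theta>\<^sup>2 / 2)
      - exp (- ((a + b) / 2 + 1) * \<theta>\<^sup>2 / 2)) \<le> 4 * \<bar>\<theta>\<bar> ^ 3"
proof -
  define p where "p = - (a - b) * \<theta>\<^sup>2 / 4"
  define E where "E = exp (- ((a + b) / 2) * \<theta>\<^sup>2 / 2)"
  have E: "0 \<le> E" "E \<le> 1"
    using ab by (auto simp: E_def)
  have \<theta>2: "\<theta>\<^sup>2 \<le> 1" using \<theta> by (simp add: abs_square_le_1)
  have "\<bar>p\<bar> = \<bar>a - b\<bar> / 4 * \<theta>\<^sup>2" by (simp add: p_def abs_mult abs_minus_commute)
  also have "\<dots> \<le> 2 / 4 * \<theta>\<^sup>2" using ab by (intro mult_right_mono) auto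
  finally have p: "\<bar>p\<bar> \<le> \<theta>\<^sup>2 / 2" by simp
  have p2: "p\<^sup>2 \<le> \<bar>\<theta>\<bar> ^ 3 / 4"
  proof -
    have "p\<^sup>2 \<le> (\<theta>\<^sup>2 / 2)\<^sup>2" using p by (metis abs_ge_zero power2_abs power_mono)
    also have "\<dots> = \<bar>\<theta>\<bar> ^ 3 / 4 * \<bar>\<theta>\<bar>" by (simp add: power2_eq_square power3_eq_cube abs_mult)
    also have "\<dots> \<le> \<bar>\<theta>\<bar> ^ 3 / 4 * 1" using \<theta> by (intro mult_left_mono) auto
    finally show ?thesis by simp
  qed
  have q: "\<bar>\<theta>\<^sup>2 / 2\<bar> \<le> 1 / 2" "\<bar>p\<bar> \<le> 1 / 2" "\<bar>- p\<bar> \<le> 1 / 2" using \<theta>2 p by auto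
  have e1: "\<bar>exp p - (1 + p)\<bar> \<le> p\<^sup>2" "\<bar>exp (- p) - (1 - p)\<bar> \<le> p\<^sup>2"
    using abs_exp_minus_linear_le[OF q(2)] abs_exp_minus_linear_le[OF q(3)] by auto
  have "\<bar>exp (- \<theta>\<^sup>2 / 2) - (1 - \<theta>\<^sup>2 / 2)\<bar> \<le> (\<theta>\<^sup>2 / 2)\<^sup>2"
    using abs_exp_minus_linear_le[of "- \<theta>\<^sup>2 / 2"] q by simp
  also have "\<dots> = \<bar>\<theta>\<bar> ^ 3 / 4 * \<bar>\<theta>\<bar>" by (simp add: power2_eq_square power3_eq_cube abs_mult)
  also have "\<dots> \<le> \<bar>\<theta>\<bar> ^ 3 / 4 * 1" using \<theta> by (intro mult_left_mono) auto
  finally have e2: "\<bar>exp (- \<theta>\<^sup>2 / 2) - (1 - \<theta>\<^sup>2 / 2)\<bar> \<le> \<bar>\<theta>\<bar> ^ 3 / 4" by simp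
  \<comment> \<open>These are cosh p and sinh p: dividing the mixture by E leaves C cos \<theta> + i
    S sin \<theta>.\<close>
  define C where "C = exp p / 2 + exp (- p) / 2"
  define S where "S = exp p / 2 - exp (- p) / 2"
  have C: "\<bar>C - 1\<bar> \<le> \<bar>\<theta>\<bar> ^ 3 / 4" using e1 p2 unfolding C_def by linarith
  have "\<bar>S\<bar> \<le> \<bar>p\<bar> + p\<^sup>2" using e1 unfolding S_def by linarith
  also have "\<dots> \<le> \<theta>\<^sup>2 / 2 + \<theta>\<^sup>2 / 4"
  proof -
    have "\<bar>\<theta>\<bar> ^ 3 \<le> \<bar>\<theta>\<bar> ^ 2" using \<theta> by (intro power_decreasing) auto
    then show ?thesis using p p2 by simp
  qed
  finally have S: "\<bar>S\<bar> \<le> \<theta>\<^sup>2" by simp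
  have factor: "cis \<theta> / 2 * exp (- a * \<theta>\<^sup>2 / 2) + cis (- \<theta>) / 2 * exp (- b * \<theta>\<^sup>2 / 2)
      - exp (- ((a + b) / 2 + 1) * \<theta>\<^sup>2 / 2)
    = E * (cis \<theta> / 2 * exp p + cis (- \<theta>) / 2 * exp (- p) - exp (- \<theta>\<^sup>2 / 2))"
  proof -
    have "exp (- a * \<theta>\<^sup>2 / 2) = E * exp p" "exp (- b * \<theta>\<^sup>2 / 2) = E * exp (- p)"
      "exp (- ((a + b) / 2 + 1) * \<theta>\<^sup>2 / 2) = E * exp (- \<theta>\<^sup>2 / 2)"
      unfolding E_def p_def exp_add[symmetric] by (simp_all add: field_simps)
    then show ?thesis by (simp add: algebra_simps)
  qed
  define z where "z = Complex (cos \<theta> * C - exp (- \<theta>\<^sup>2 / 2)) (sin \<theta> * S)"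
  have z_eq: "cis \<theta> / 2 * exp p + cis (- \<theta>) / 2 * exp (- p) - exp (- \<theta>\<^sup>2 / 2) = z"
    by (simp add: complex_eq_iff C_def S_def z_def algebra_simps)
  have "norm (E * z) \<le> norm z"
    using E by (simp add: norm_mult mult_left_le_one_le)
  moreover have "norm z \<le> \<bar>cos \<theta> * C - exp (- \<theta>\<^sup>2 / 2)\<bar> + \<bar>sin \<theta> * S\<bar>"
    using cmod_le[of z] by (simp add: z_def)
  moreover have "\<bar>sin \<theta> * S\<bar> \<le> \<bar>\<theta>\<bar> * \<theta>\<^sup>2"
    unfolding abs_mult using S abs_sin_x_le_abs_x[of \<theta>] by (intro mult_mono) auto
  moreover have "\<bar>\<theta>\<bar> * \<theta>\<^sup>2 = \<bar>\<theta>\<bar> ^ 3"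
    by (simp add: power2_eq_square power3_eq_cube)
  moreover have "cos \<theta> * C = cos \<theta> * (C - 1) + cos \<theta>"
    by (simp add: algebra_simps)
  moreover have "\<bar>cos \<theta> * (C - 1)\<bar> \<le> 1 * (\<bar>\<theta>\<bar> ^ 3 / 4)"
    unfolding abs_mult using C by (intro mult_mono) auto
  moreover note abs_cos_minus_quadratic_le[of \<theta>] e2
  \<comment> \<open>The real part contributes 1 from cos \<theta>, 1/4 from the exponential and 1/4
    from C, the imaginary part 1, so 4 leaves room.\<close>
  ultimately have "norm (E * z) \<le> 4 * \<bar>\<theta>\<bar> ^ 3" by linarith
  then show ?thesis unfolding factor z_eq .
qed

text \<open>With c = 4|\<theta>|^3, an odd step averages the two earlier errors and adds at most c,
  and an even step adds nothing. This is the recurrence of c * \<open>kappa2\<close>, so the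
  induction compares the two.\<close>

lemma norm_char_fun_minus_gaussian_le:
  assumes \<theta>: "\<bar>\<theta>\<bar> \<le> 1" and t: "t > 0"
  shows "norm (char_fun t \<theta> - exp (- kappa2 t * \<theta>\<^sup>2 / 2)) \<le> 4 * \<bar>\<theta>\<bar> ^ 3 * kappa2 t"
proof -
  define d where "d t = norm (char_fun t \<theta> - exp (- kappa2 t * \<theta>\<^sup>2 / 2))" for t
  have mix: "norm (cis \<theta> / 2 * z + cis (- \<theta>) / 2 * w - exp (- ((a + b) / 2 + 1) * \<theta>\<^sup>2 / 2))
     \<le> (norm (z - exp (- a * \<theta>\<^sup>2 / 2)) + norm (w - exp (- b * \<theta>\<^sup>2 / 2))) / 2 + 4 * \<bar>\<theta>\<bar> ^ 3"
    if "\<bar>a - b\<bar> \<le> 2" "a + b \<ge> 0" for a b z w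
  proof -
    have eq: "cis \<theta> / 2 * z + cis (- \<theta>) / 2 * w - exp (- ((a + b) / 2 + 1) * \<theta>\<^sup>2 / 2)
      = cis \<theta> / 2 * (z - exp (- a * \<theta>\<^sup>2 / 2)) + cis (- \<theta>) / 2 * (w - exp (- b * \<theta>\<^sup>2 / 2))
       + (cis \<theta> / 2 * exp (- a * \<theta>\<^sup>2 / 2) + cis (- \<theta>) / 2 * exp (- b * \<theta>\<^sup>2 / 2)
      - exp (- ((a + b) / 2 + 1) * \<theta>\<^sup>2 / 2))" (is "_ = ?A + ?B + ?C")
      by (simp add: algebra_simps)
    have tri: "norm (u + v + w) \<le> norm u + norm v + norm w" for u v w :: complex
      by (meson norm_triangle_le norm_triangle_ineq add_right_mono)
    have *: "norm (cis \<theta> / 2 * z + cis (- \<theta>) / 2 * w - exp (- ((a + b) / 2 + 1) * \<theta>\<^sup>2 / 2))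
      \<le> norm ?A + norm ?B + norm ?C"
      unfolding eq by (rule tri)
    have half: "norm (cis x / 2 * u) = norm u / 2" for x u
      by (simp add: norm_mult norm_divide)
    have A: "norm ?A = norm (z - exp (- a * \<theta>\<^sup>2 / 2)) / 2"
      and B: "norm ?B = norm (w - exp (- b * \<theta>\<^sup>2 / 2)) / 2"
      by (rule half)+
    have C: "norm ?C \<le> 4 * \<bar>\<theta>\<bar> ^ 3"
      by (rule cis_mixture_approx[OF \<theta> that])
    show ?thesis
      using * C unfolding A B add_divide_distrib by linarith
  qed
  have step: "d (Suc (2 * t)) \<le> (d t + d (Suc t)) / 2 + 4 * \<bar>\<theta>\<bar> ^ 3" if "t > 0" for t
    unfolding d_def char_fun_double_Suc kappa2_double_Suc[OF that]
    using kappa2_estimates[of t] kappa2_estimates[of "Suc t"] that by (intro mix) auto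
  \<comment> \<open>The recurrence for odd arguments persists at 0 when the variance there is read as 0.\<close>
  have "d 1 \<le> d 1 / 2 + 4 * \<bar>\<theta>\<bar> ^ 3"
    using mix[of 0 2 1 "char_fun 1 \<theta>"] char_fun_double_Suc[of 0 \<theta>] by (simp add: d_def)
  then have d1: "d 1 \<le> 4 * \<bar>\<theta>\<bar> ^ 3 * kappa2 1" by simp
  define c where "c = 4 * \<bar>\<theta>\<bar> ^ 3"
  have kappa: "c * kappa2 (Suc (2 * t)) = (c * kappa2 t + c * kappa2 (Suc t)) / 2 + c" if "t > 0" for t
    unfolding kappa2_double_Suc[OF that] by (simp add: algebra_simps add_divide_distrib)
  have d: "d (2 * t) = d t" "d (Suc (Suc (2 * t))) = d (Suc t)" if "t > 0" for t
    by (simp_all add: d_def char_fun_double char_fun_double_Suc_Suc kappa2_double[OF that] kappa2_double_Suc_Suc)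
  note step' = step[folded c_def]
  have "t > 0 \<longrightarrow> d t \<le> c * kappa2 t \<and> d (Suc t) \<le> c * kappa2 (Suc t)"
  proof (induction t rule: binary_induct)
    case (double t)
    then show ?case
      using step'[of t] kappa[of t] d[of t] by (simp add: kappa2_double add_divide_distrib)
  next
    case (double_Suc t)
    show ?case
    proof (cases "t = 0")
      case True
      have "d (Suc (Suc 0)) = d 1"
        using char_fun_double_Suc_Suc[of 0] kappa2_double_Suc_Suc[of 0] by (simp add: d_def)
      then show ?thesis
        using d1 True kappa2_double_Suc_Suc[of 0] by (simp add: c_def)
    next
      case False
      then show ?thesis
        using double_Suc step'[of t] kappa[of t] d[of t] by (simp add: kappa2_double_Suc_Suc add_divide_distrib)
    qed
  qed simp
  then show ?thesis using t by (simp add: d_def c_def)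
qed

subsection \<open>Densities as Fourier coefficients\<close>

text \<open>The candidate value of \<open>delta\<close>, given by Fourier inversion so that it is
  available before the limit is known to exist.\<close>

definition fourier_coeff :: "int \<Rightarrow> nat \<Rightarrow> real" where
  "fourier_coeff j t =
    Re (integral {- pi..pi} (\<lambda>\<theta>. cis (- of_int j * \<theta>) * char_fun t \<theta>)) / (2 * pi)"

lemma fourier_integrable:
  "(\<lambda>\<theta>. cis (- of_int j * \<theta>) * char_fun t \<theta>) integrable_on {a..b}"
  by (intro integrable_continuous_real continuous_intros
      continuous_on_subset[OF continuous_on_char_fun]) auto

lemma fourier_coeff_double: "fourier_coeff j (2 * t) = fourier_coeff j t"
  by (simp add: fourier_coeff_def char_fun_double)

lemma fourier_coeff_double_Suc:
  "fourier_coeff j (Suc (2 * t)) = (fourier_coeff (j - 1) t + fourier_coeff (j + 1) (Suc t)) / 2"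
proof -
  have "cis (- of_int j * \<theta>) * char_fun (Suc (2 * t)) \<theta> =
      (1 / 2) * (cis (- of_int (j - 1) * \<theta>) * char_fun t \<theta>)
      + (1 / 2) * (cis (- of_int (j + 1) * \<theta>) * char_fun (Suc t) \<theta>)" for \<theta>
  proof -
    have "cis (- of_int (j - 1) * \<theta>) = cis (- of_int j * \<theta>) * cis \<theta>"
      "cis (- of_int (j + 1) * \<theta>) = cis (- of_int j * \<theta>) * cis (- \<theta>)"
      by (simp_all add: cis_mult algebra_simps)
    then show ?thesis by (simp only: char_fun_double_Suc) (simp add: algebra_simps)
  qed
  then have "integral {- pi..pi} (\<lambda>\<theta>. cis (- of_int j * \<theta>) * char_fun (Suc (2 * t)) \<theta>) =
      (1 / 2) * integral {- pi..pi} (\<lambda>\<theta>. cis (- of_int (j - 1) * \<theta>) * char_fun t \<theta>)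
      + (1 / 2) * integral {- pi..pi} (\<lambda>\<theta>. cis (- of_int (j + 1) * \<theta>) * char_fun (Suc t) \<theta>)"
    by (simp only: integral_add integral_mult_right fourier_integrable integrable_on_mult_right)
  then show ?thesis
    unfolding fourier_coeff_def by (simp only:) (simp add: add_divide_distrib)
qed

lemma fourier_coeff_0: "fourier_coeff j 0 = (if j = 0 then 1 else 0)"
proof (cases "j = 0")
  case True
  then show ?thesis by (simp add: fourier_coeff_def)
next
  case False
  have "((\<lambda>\<theta>. cis (- of_int j * \<theta>)) has_integral
      cis (- of_int j * pi) / (- \<i> * of_int j) - cis (- of_int j * (- pi)) / (- \<i> * of_int j)) {- pi..pi}"
  proof (rule fundamental_theorem_of_calculus)
    fix x
    show "((\<lambda>\<theta>. cis (- of_int j * \<theta>) / (- \<i> * of_int j)) has_vector_derivative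
        cis (- of_int j * x)) (at x within {- pi..pi})"
    proof -
      have "((\<lambda>z. exp (- \<i> * of_int j * z) / (- \<i> * of_int j)) has_field_derivative
          exp (- \<i> * of_int j * of_real x)) (at (of_real x))"
        using False by (auto intro!: derivative_eq_intros)
      then have "((\<lambda>\<theta>. exp (- \<i> * of_int j * of_real \<theta>) / (- \<i> * of_int j)) has_vector_derivative
          exp (- \<i> * of_int j * of_real x)) (at x within {- pi..pi})"
        by (rule has_vector_derivative_real_field)
      then show ?thesis by (simp add: cis_conv_exp mult.assoc)
    qed
  qed simp
  \<comment> \<open>The arguments differ by j full periods, so the antiderivative takes equal values
    at both ends.\<close>
  moreover have "cis (- of_int j * pi) = cis (- of_int j * (- pi))"
  proof -
    have "cis (of_int j * pi) = cis (2 * pi * of_int j) * cis (- of_int j * pi)"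
      by (simp add: cis_mult algebra_simps)
    also have "cis (2 * pi * of_int j) = 1" by (rule cis_multiple_2pi) simp
    finally show ?thesis by simp
  qed
  ultimately have "integral {- pi..pi} (\<lambda>\<theta>. cis (- of_int j * \<theta>)) = 0"
    by (simp add: integral_unique)
  then show ?thesis using False by (simp add: fourier_coeff_def)
qed

lemma abs_fourier_coeff_le: "\<bar>fourier_coeff j t\<bar> \<le> 1"
proof -
  have "norm (integral {- pi..pi} (\<lambda>\<theta>. cis (- of_int j * \<theta>) * char_fun t \<theta>))
      \<le> integral {- pi..pi} (\<lambda>\<theta>. 1)"
    by (rule integral_norm_bound_integral[OF fourier_integrable])
       (use norm_char_fun_le_1 in \<open>auto simp: norm_mult\<close>)
  then have "\<bar>Re (integral {- pi..pi} (\<lambda>\<theta>. cis (- of_int j * \<theta>) * char_fun t \<theta>))\<bar> \<le> 2 * pi"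
    using abs_Re_le_cmod order_trans by fastforce
  then show ?thesis by (simp add: fourier_coeff_def abs_divide)
qed

text \<open>For j \<ge> 2 the recurrence at t = 0 has no contribution from t = 0 and says that the
  coefficient doubles as j increases by 1; boundedness then forces it to vanish.\<close>

lemma fourier_coeff_1_eq_0:
  assumes "j \<ge> 2"
  shows "fourier_coeff j 1 = 0"
proof -
  have halve: "fourier_coeff i 1 = fourier_coeff (i + 1) 1 / 2" if "i \<ge> 2" for i
    using fourier_coeff_double_Suc[of i 0] that by (simp add: fourier_coeff_0)
  have eq: "fourier_coeff j 1 = fourier_coeff (j + int k) 1 / 2 ^ k" for k
  proof (induction k)
    case (Suc k)
    have "fourier_coeff (j + int k) 1 = fourier_coeff (j + int (Suc k)) 1 / 2"
      using halve[of "j + int k"] assms by (simp add: add_ac)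
    then show ?case using Suc by (simp add: field_simps)
  qed simp
  have "(\<lambda>k. (1 / 2) ^ k) \<longlonglongrightarrow> (0 :: real)" by (rule LIMSEQ_power_zero) simp
  moreover have "\<bar>fourier_coeff j 1\<bar> \<le> (1 / 2) ^ k" for k
    using abs_fourier_coeff_le[of "j + int k" 1] eq[of k] by (simp add: abs_divide power_divide divide_simps)
  ultimately have "\<bar>fourier_coeff j 1\<bar> \<le> 0"
    by (intro LIMSEQ_le_const) auto
  then show ?thesis by simp
qed

section \<open>Existence and value of the densities\<close>

lemma density_even_odd:
  fixes P :: "nat \<Rightarrow> bool" and x y :: real
  assumes "(\<lambda>N. real (card {n. n < N \<and> P (2 * n)}) / real N) \<longlonglongrightarrow> x"
    and "(\<lambda>N. real (card {n. n < N \<and> P (Suc (2 * n))}) / real N) \<longlonglongrightarrow> y"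
  shows "(\<lambda>N. real (card {n. n < N \<and> P n}) / real N) \<longlonglongrightarrow> (x + y) / 2"
proof -
  define a where "a N = real (card {n. n < N \<and> P (2 * n)})" for N
  define b where "b N = real (card {n. n < N \<and> P (Suc (2 * n))})" for N
  have split: "real (card {n. n < N \<and> P n}) = a ((N + 1) div 2) + b (N div 2)" for N
  proof -
    have "{n. n < N \<and> P n} = (\<lambda>n. 2 * n) ` {n. n < (N + 1) div 2 \<and> P (2 * n)}
        \<union> (\<lambda>n. Suc (2 * n)) ` {n. n < N div 2 \<and> P (Suc (2 * n))}" (is "?L = ?R")
    proof (rule set_eqI)
      fix n
      show "n \<in> ?L \<longleftrightarrow> n \<in> ?R"
      proof (cases "even n")
        case True
        then obtain m where "n = 2 * m" by (auto elim: evenE)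
        then show ?thesis by (auto simp: image_iff; presburger)
      next
        case False
        then obtain m where "n = Suc (2 * m)" by (auto elim: oddE)
        then show ?thesis by (auto simp: image_iff; presburger)
      qed
    qed
    moreover have "(\<lambda>n. 2 * n) ` {n. n < (N + 1) div 2 \<and> P (2 * n)}
        \<inter> (\<lambda>n. Suc (2 * n)) ` {n. n < N div 2 \<and> P (Suc (2 * n))} = {}"
      by auto presburger
    ultimately show ?thesis
      unfolding a_def b_def by (simp add: card_Un_disjoint card_image inj_on_def)
  qed
  \<comment> \<open>The conditions on g say that 2 * g N differs from N by at most 1, which covers
    the even and the odd numbers below N. \<open>f 0 = 0\<close> settles g N = 0, where the quotient
    by g N is 0 by convention.\<close>
  have half: "(\<lambda>N. f (g N) / real N) \<longlonglongrightarrow> z * (1 / 2)"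
    if lim: "(\<lambda>N. f N / real N) \<longlonglongrightarrow> z" and g: "\<And>N. N \<le> 2 * g N + 1" "\<And>N. 2 * g N \<le> N + 1"
      and f0: "f 0 = 0"
    for f :: "nat \<Rightarrow> real" and g :: "nat \<Rightarrow> nat" and z
  proof -
    have "filterlim g at_top sequentially"
      unfolding filterlim_at_top
    proof
      fix Z :: nat
      show "\<forall>\<^sub>F N in sequentially. Z \<le> g N"
        using eventually_ge_at_top[of "2 * Z + 1"]
      proof eventually_elim
        case (elim N)
        then show ?case using g(1)[of N] by linarith
      qed
    qed
    then have "(\<lambda>N. f (g N) / real (g N)) \<longlonglongrightarrow> z"
      using lim by (rule filterlim_compose[rotated])
    moreover have "(\<lambda>N. real (g N) / real N) \<longlonglongrightarrow> 1 / 2"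
    proof (rule LIM_zero_cancel, rule Lim_null_comparison)
      show "\<forall>\<^sub>F N in sequentially. norm (real (g N) / real N - 1 / 2) \<le> 1 / real N"
        using eventually_gt_at_top[of 0]
      proof eventually_elim
        case (elim N)
        have "real N \<le> 2 * real (g N) + 1" "2 * real (g N) \<le> real N + 1"
          using g[of N] by linarith+
        then show ?case using elim by (simp add: abs_le_iff field_simps)
      qed
    qed (rule lim_const_over_n)
    ultimately have "(\<lambda>N. f (g N) / real (g N) * (real (g N) / real N)) \<longlonglongrightarrow> z * (1 / 2)"
      by (rule tendsto_mult)
    moreover have "f (g N) / real (g N) * (real (g N) / real N) = f (g N) / real N" for N
      using f0 by (cases "g N = 0") auto
    ultimately show ?thesis by (simp only:)
  qed
  have "(\<lambda>N. a ((N + 1) div 2) / real N + b (N div 2) / real N) \<longlonglongrightarrow> x * (1 / 2) + y * (1 / 2)"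
    by (intro tendsto_add half) (use assms in \<open>auto simp: a_def b_def\<close>)
  then show ?thesis unfolding split by (simp add: add_divide_distrib)
qed

text \<open>Existence of the limit is proved together with its value: densities and
  \<open>fourier_coeff\<close> share the digit recurrence, with base cases t = 0 and t = 1.\<close>

lemma density_fourier_coeff:
  "(\<lambda>N. real (card {n. n < N \<and> int (bin_digit_sum (n + t)) - int (bin_digit_sum n) = j}) / real N)
    \<longlonglongrightarrow> fourier_coeff j t"
proof -
  define Q where "Q t j \<longleftrightarrow>
    (\<lambda>N. real (card {n. n < N \<and> int (bin_digit_sum (n + t)) - int (bin_digit_sum n) = j}) / real N)
    \<longlonglongrightarrow> fourier_coeff j t" for t j
  have even: "Q (2 * t) j" if "Q t j" for t j
  proof -
    have *: "2 * n + 2 * t = 2 * (n + t)" "Suc (2 * n) + 2 * t = Suc (2 * (n + t))" for n by auto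
    have "(\<lambda>N. real (card {n. n < N \<and>
        int (bin_digit_sum (n + 2 * t)) - int (bin_digit_sum n) = j}) / real N)
      \<longlonglongrightarrow> (fourier_coeff j t + fourier_coeff j t) / 2"
      by (rule density_even_odd)
         (use that in \<open>simp_all only: * bin_digit_sum_double bin_digit_sum_double_Suc Q_def
           of_nat_Suc add_diff_cancel_left\<close>)
    then show ?thesis by (simp add: Q_def fourier_coeff_double)
  qed
  have odd: "Q (Suc (2 * t)) j" if "Q t (j - 1)" "Q (Suc t) (j + 1)" for t j
  proof -
    \<comment> \<open>For even n the last digit enters without a carry and adds a 1; for odd n it
      carries, so t becomes t + 1 and the last 1 of n is lost.\<close>
    have *: "2 * n + Suc (2 * t) = Suc (2 * (n + t))"
      "Suc (2 * n) + Suc (2 * t) = 2 * (n + Suc t)" for n by auto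
    have **: "int (Suc p) - int q = j \<longleftrightarrow> int p - int q = j - 1"
      "int p - int (Suc q) = j \<longleftrightarrow> int p - int q = j + 1" for p q by auto
    show ?thesis
      unfolding Q_def fourier_coeff_double_Suc
      by (rule density_even_odd)
         (use that in \<open>simp_all only: * ** bin_digit_sum_double bin_digit_sum_double_Suc Q_def\<close>)
  qed
  have Q0: "Q 0 j" for j
  proof -
    have "(\<lambda>N. real (card {n. n < N \<and> 0 = j}) / real N) \<longlonglongrightarrow> (if j = 0 then 1 else 0)"
      by (intro tendsto_eventually eventually_mono[OF eventually_gt_at_top[of 0]]) auto
    then show ?thesis by (simp add: Q_def fourier_coeff_0 eq_commute[of 0 j])
  qed
  have Q1_large: "Q 1 j" if "j \<ge> 2" for j
  proof -
    have "int (bin_digit_sum (n + 1)) - int (bin_digit_sum n) \<noteq> j" for n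
      using bin_digit_sum_Suc_le[of n] that by simp
    then show ?thesis using fourier_coeff_1_eq_0[OF that] by (simp add: Q_def)
  qed
  have Q1: "Q 1 j" for j
  proof (cases "j \<ge> 2")
    case False
    \<comment> \<open>At t = 0 the odd rule refers back to t = 1 with j + 1 in place of j, so j
      descends from 2, where the density vanishes.\<close>
    then have "j \<le> 2" by simp
    then show ?thesis
    proof (induction j rule: int_le_induct)
      case base
      show ?case by (rule Q1_large) simp
    next
      case (step i)
      then show ?case using odd[of 0 "i - 1"] Q0 by simp
    qed
  qed (rule Q1_large)
  have "(\<forall>j. Q t j) \<and> (\<forall>j. Q (Suc t) j)"
  proof (induction t rule: binary_induct)
    case zero
    then show ?case using Q0 Q1 by simp
  next
    case (double t)
    then show ?case using even odd by blast
  next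
    case (double_Suc t)
    then show ?case using even[of "Suc t"] odd[of t] by simp
  qed
  then show ?thesis by (simp add: Q_def)
qed

lemma delta_eq_fourier_coeff: "delta j t = fourier_coeff j t"
  unfolding delta_def using density_fourier_coeff by (rule limI)

subsection \<open>Fourier inversion\<close>

text \<open>After scaling by sqrt \<kappa> this is the characteristic function of the standard
  normal distribution at -x / sqrt \<kappa>.\<close>

lemma has_bochner_integral_gaussian_fourier:
  fixes \<kappa> x :: real
  assumes "\<kappa> > 0"
  shows "has_bochner_integral lborel (\<lambda>\<theta>. cis (- x * \<theta>) * exp (- \<kappa> * \<theta>\<^sup>2 / 2))
    (complex_of_real (2 * pi * (1 / sqrt (2 * pi * \<kappa>) * exp (- x\<^sup>2 / (2 * \<kappa>)))))"
proof -
  define s where "s = sqrt \<kappa>"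
  have s: "s > 0" "s\<^sup>2 = \<kappa>" using assms by (auto simp: s_def)
  define y where "y = - x / s"
  let ?f = "\<lambda>u. std_normal_density u *\<^sub>R iexp (y * u)"
  have int: "integrable lborel ?f"
    by (rule Bochner_Integration.integrable_bound[OF integrable_normal_density[of 1 0]]) auto
  have "integral\<^sup>L lborel ?f = char std_normal_distribution y"
    unfolding char_def by (subst integral_density) auto
  also have "\<dots> = exp (- y\<^sup>2 / 2)" by (simp add: char_std_normal_distribution)
  finally have "has_bochner_integral lborel ?f (complex_of_real (exp (- y\<^sup>2 / 2)))"
    using int by (simp add: has_bochner_integral_iff)
  then have "has_bochner_integral lborel (\<lambda>\<theta>. ?f (0 + s * \<theta>)) (complex_of_real (exp (- y\<^sup>2 / 2)) /\<^sub>R \<bar>s\<bar>)"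
    using s by (subst (asm) lborel_has_bochner_integral_real_affine_iff[where c = s and t = 0]) auto
  then have "has_bochner_integral lborel (\<lambda>\<theta>. complex_of_real (sqrt (2 * pi)) * ?f (0 + s * \<theta>))
      (complex_of_real (sqrt (2 * pi)) * (complex_of_real (exp (- y\<^sup>2 / 2)) /\<^sub>R \<bar>s\<bar>))"
    by (rule has_bochner_integral_mult_right)
  moreover have "complex_of_real (sqrt (2 * pi)) * ?f (0 + s * \<theta>)
      = cis (- x * \<theta>) * exp (- \<kappa> * \<theta>\<^sup>2 / 2)" for \<theta>
  proof -
    have "iexp (y * (0 + s * \<theta>)) = cis (- x * \<theta>)"
      using s by (simp add: y_def cis_conv_exp)
    moreover have "sqrt (2 * pi) * std_normal_density (0 + s * \<theta>) = exp (- \<kappa> * \<theta>\<^sup>2 / 2)"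
      using s by (simp add: std_normal_density_def power_mult_distrib)
    moreover have "complex_of_real a * r *\<^sub>R z = z * complex_of_real b"
      if "a * r = b" for a r b :: real and z :: complex
      using that by (auto simp: scaleR_conv_of_real)
    ultimately show ?thesis by simp
  qed
  moreover have "complex_of_real (sqrt (2 * pi)) * (complex_of_real (exp (- y\<^sup>2 / 2)) /\<^sub>R \<bar>s\<bar>)
      = complex_of_real (2 * pi * (1 / sqrt (2 * pi * \<kappa>) * exp (- x\<^sup>2 / (2 * \<kappa>))))"
  proof -
    have "y\<^sup>2 = x\<^sup>2 / \<kappa>" using s by (simp add: y_def power_divide)
    then have "exp (- y\<^sup>2 / 2) = exp (- x\<^sup>2 / (2 * \<kappa>))" by (simp add: field_simps)
    moreover have "2 * pi / sqrt (2 * pi * \<kappa>) = sqrt (2 * pi) / s"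
    proof -
      have "2 * pi = sqrt (2 * pi) * sqrt (2 * pi)" by simp
      then show ?thesis using s by (simp add: real_sqrt_mult s_def field_simps)
    qed
    moreover have "2 * pi * (1 / sqrt (2 * pi * \<kappa>) * z) = 2 * pi / sqrt (2 * pi * \<kappa>) * z" for z
      by simp
    ultimately have "2 * pi * (1 / sqrt (2 * pi * \<kappa>) * exp (- x\<^sup>2 / (2 * \<kappa>)))
        = sqrt (2 * pi) / s * exp (- y\<^sup>2 / 2)"
      by (simp only:)
    moreover have "complex_of_real a * (complex_of_real b /\<^sub>R \<bar>s\<bar>) = complex_of_real (a / s * b)" for a b
      using s(1) by (simp add: scaleR_conv_of_real divide_inverse)
    ultimately show ?thesis by (simp only:)
  qed
  ultimately show ?thesis by (simp only:)
qed

text \<open>Frequency 0 of the transform above; it evaluates the Gaussian tail of the majorant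
  below.\<close>

lemma has_bochner_integral_gaussian:
  fixes \<kappa> :: real
  assumes "\<kappa> > 0"
  shows "has_bochner_integral lborel (\<lambda>\<theta>. exp (- \<kappa> * \<theta>\<^sup>2 / 2)) (2 * pi / sqrt (2 * pi * \<kappa>))"
proof -
  have "has_bochner_integral lborel
      (\<lambda>\<theta>. Re (cis (- 0 * \<theta>) * complex_of_real (exp (- \<kappa> * \<theta>\<^sup>2 / 2))))
      (Re (complex_of_real (2 * pi * (1 / sqrt (2 * pi * \<kappa>) * exp (- 0\<^sup>2 / (2 * \<kappa>))))))"
    by (rule has_bochner_integral_bounded_linear[OF bounded_linear_Re
          has_bochner_integral_gaussian_fourier[OF assms]])
  moreover have "Re (cis (- 0 * \<theta>) * complex_of_real r) = r" for \<theta> r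
    by simp
  moreover have "2 * pi * (1 / r * exp (- 0\<^sup>2 / (2 * \<kappa>))) = 2 * pi / r" for r :: real
    by simp
  ultimately show ?thesis by (simp only: Re_complex_of_real)
qed

section \<open>Comparison of the two inversion integrals\<close>

text \<open>The integrands F and G are compared through one integrable majorant H on the whole line.
  The threshold exp 96 gives L > 96, so the decay exponent at the cut-off, m \<theta>0^2 / 96 = L^2
  / 96, is at least L and the tail is at most 1/m.\<close>

lemma delta_gaussian_estimate:
  assumes t: "t > 0" and M: "real (num_blocks t) > exp 96"
  defines "m \<equiv> real (num_blocks t)"
  shows "\<bar>delta j t - 1 / sqrt (2 * pi * kappa2 t) * exp (- (real_of_int j)\<^sup>2 / (2 * kappa2 t))\<bar>
      \<le> 48 * (1 / m) * ln m ^ 4"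
proof -
  define \<kappa> where "\<kappa> = kappa2 t"
  define L where "L = ln m"
  define \<theta>0 where "\<theta>0 = L / sqrt m"
  have m0: "m > 0" using less_trans[OF exp_gt_zero M] by (simp only: m_def)
  have L: "L > 96" using ln_less_cancel_iff[of "exp 96" m] M m0 by (simp add: L_def m_def)
  have m: "m = exp L" using m0 by (simp add: L_def)
  have m1: "m \<ge> 1" using L by (simp add: m)
  have \<kappa>: "m \<le> \<kappa>" "\<kappa> \<le> 4 * m" "\<kappa> > 0"
    using kappa2_estimates[OF t] m0 by (auto simp: \<kappa>_def m_def)
  \<comment> \<open>This leads to L \<le> sqrt m, hence \<theta>0 \<le> 1, the range in which the
    Gaussian approximation holds.\<close>
  have "sqrt m = exp (L / 4) ^ 2"
    by (rule real_sqrt_unique) (simp_all add: m flip: exp_of_nat_mult)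
  also have "\<dots> \<ge> (1 + L / 4) ^ 2"
    using L exp_ge_add_one_self[of "L / 4"] by (intro power_mono) auto
  also have "(1 + L / 4) ^ 2 = 1 + L / 2 + L * L / 16" by (simp add: power2_eq_square field_simps)
  finally have "1 + L / 2 + L * L / 16 \<le> sqrt m" .
  moreover have "L * L \<ge> 96 * L" using L by (intro mult_right_mono) auto
  ultimately have "L \<le> sqrt m" using L by linarith
  then have \<theta>0: "0 \<le> \<theta>0" "\<theta>0 \<le> 1" using L m0 by (auto simp: \<theta>0_def)
  have \<theta>02: "m * \<theta>0\<^sup>2 = L\<^sup>2" using m0 by (simp add: \<theta>0_def power_divide)
  have \<theta>04: "\<theta>0 ^ 4 = L ^ 4 / m\<^sup>2"
    using m0 by (simp add: \<theta>0_def power_divide power4_eq_xxxx power2_eq_square)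
  \<comment> \<open>Used with c = 1/96 for \<open>char_fun\<close> and with c = 1/4 for half of the
    Gaussian exponent.\<close>
  have small: "exp (- c * (m * \<theta>\<^sup>2)) \<le> 1 / m" if "c \<ge> 1 / 96" "\<bar>\<theta>\<bar> \<ge> \<theta>0" for c \<theta>
  proof -
    have "L = 1 / 96 * (96 * L)" by simp
    also have "\<dots> \<le> c * (L * L)"
      using that L by (intro mult_mono) auto
    also have "L * L = m * \<theta>0\<^sup>2" unfolding \<theta>02 by (simp add: power2_eq_square)
    finally have "L \<le> c * (m * \<theta>0\<^sup>2)" .
    moreover have "\<theta>0\<^sup>2 \<le> \<theta>\<^sup>2"
      using power_mono[OF that(2) \<theta>0(1), of 2] by simp
    then have "c * (m * \<theta>0\<^sup>2) \<le> c * (m * \<theta>\<^sup>2)"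
      using that m0 by (intro mult_left_mono) auto
    ultimately have "L \<le> c * (m * \<theta>\<^sup>2)" by (rule order_trans)
    then have "exp (- c * (m * \<theta>\<^sup>2)) \<le> exp (- L)" by simp
    also have "\<dots> = 1 / m" by (simp add: m exp_minus field_simps)
    finally show ?thesis .
  qed
  define F where "F \<theta> = indicator {- pi..pi} \<theta> *\<^sub>R (cis (- of_int j * \<theta>) * char_fun t \<theta>)" for \<theta>
  define G where "G \<theta> = cis (- of_int j * \<theta>) * complex_of_real (exp (- \<kappa> * \<theta>\<^sup>2 / 2))" for \<theta>
  \<comment> \<open>The terms bound, in order, the error up to \<theta>0, the tail of F, and the
    tail of G; the last keeps half of its exponent to stay integrable.\<close>
  define H where "H \<theta> = 4 * \<theta>0 ^ 3 * \<kappa> * indicator {- \<theta>0..\<theta>0} \<theta> + 1 / m * indicator {- pi..pi} \<theta>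
    + 1 / m * exp (- (\<kappa> / 2) * \<theta>\<^sup>2 / 2)" for \<theta>
  have F: "set_integrable lborel {- pi..pi} (\<lambda>\<theta>. cis (- of_int j * \<theta>) * char_fun t \<theta>)"
    by (intro borel_integrable_atLeastAtMost' continuous_intros
      continuous_on_subset[OF continuous_on_char_fun]) auto
  have F_int: "integrable lborel F"
    using F unfolding F_def[abs_def] set_integrable_def .
  have "integral\<^sup>L lborel F = integral {- pi..pi} (\<lambda>\<theta>. cis (- of_int j * \<theta>) * char_fun t \<theta>)"
    using set_borel_integral_eq_integral(2)[OF F]
    unfolding F_def[abs_def] set_lebesgue_integral_def .
  then have F_val: "delta j t = Re (integral\<^sup>L lborel F) / (2 * pi)"
    by (simp only: delta_eq_fourier_coeff fourier_coeff_def)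
  have G: "has_bochner_integral lborel G
    (complex_of_real (2 * pi * (1 / sqrt (2 * pi * \<kappa>) * exp (- (of_int j)\<^sup>2 / (2 * \<kappa>)))))"
    unfolding G_def by (rule has_bochner_integral_gaussian_fourier[OF \<kappa>(3)])
  have G_val: "1 / sqrt (2 * pi * \<kappa>) * exp (- (of_int j)\<^sup>2 / (2 * \<kappa>))
      = Re (integral\<^sup>L lborel G) / (2 * pi)"
    unfolding has_bochner_integral_integral_eq[OF G] Re_complex_of_real by simp
  have "has_bochner_integral lborel H (4 * \<theta>0 ^ 3 * \<kappa> * (2 * \<theta>0) + 1 / m * (2 * pi)
      + 1 / m * (2 * pi / sqrt (2 * pi * (\<kappa> / 2))))"
    unfolding H_def
    by (intro has_bochner_integral_add has_bochner_integral_mult_right has_bochner_integral_gaussian)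
       (use \<theta>0 \<kappa> in \<open>auto simp: has_bochner_integral_iff\<close>)
  then have H_int: "integrable lborel H" and H_val: "integral\<^sup>L lborel H =
      4 * \<theta>0 ^ 3 * \<kappa> * (2 * \<theta>0) + 1 / m * (2 * pi) + 1 / m * (2 * pi / sqrt (2 * pi * (\<kappa> / 2)))"
    by (auto simp: has_bochner_integral_iff)
  have bound: "norm (F \<theta> - G \<theta>) \<le> H \<theta>" for \<theta>
  proof (cases "\<bar>\<theta>\<bar> \<le> \<theta>0")
    case True
    then have \<theta>: "\<bar>\<theta>\<bar> \<le> 1" "\<theta> \<in> {- \<theta>0..\<theta>0}" "\<theta> \<in> {- pi..pi}"
      using \<theta>0 pi_gt3 by (auto simp: abs_le_iff)
    then have "F \<theta> - G \<theta> = cis (- of_int j * \<theta>) * (char_fun t \<theta> - exp (- \<kappa> * \<theta>\<^sup>2 / 2))"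
      by (simp add: F_def G_def algebra_simps)
    then have "norm (F \<theta> - G \<theta>) = norm (char_fun t \<theta> - exp (- \<kappa> * \<theta>\<^sup>2 / 2))"
      by (simp add: norm_mult)
    also have "\<dots> \<le> 4 * \<bar>\<theta>\<bar> ^ 3 * \<kappa>"
      unfolding \<kappa>_def by (rule norm_char_fun_minus_gaussian_le[OF \<theta>(1) t])
    also have "\<dots> \<le> 4 * \<theta>0 ^ 3 * \<kappa>"
      using True \<kappa> by (intro mult_right_mono mult_left_mono power_mono) auto
    also have "\<dots> \<le> H \<theta>" using \<theta> m0 by (simp add: H_def)
    finally show ?thesis .
  next
    case False
    have "norm (F \<theta>) \<le> 1 / m * indicator {- pi..pi} \<theta>"
    proof (cases "\<theta> \<in> {- pi..pi}")
      case True
      then have "norm (F \<theta>) = norm (char_fun t \<theta>)" by (simp add: F_def norm_mult)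
      also have "\<dots> \<le> exp (- \<theta>\<^sup>2 / 96) ^ num_blocks t"
        using True by (intro norm_char_fun_le) (auto simp: abs_le_iff)
      also have "\<dots> = exp (- (1 / 96) * (m * \<theta>\<^sup>2))"
        by (simp add: m_def flip: exp_of_nat_mult)
      also have "\<dots> \<le> 1 / m" using False by (intro small) auto
      finally show ?thesis using True by simp
    qed (simp add: F_def)
    moreover have "norm (G \<theta>) \<le> 1 / m * exp (- (\<kappa> / 2) * \<theta>\<^sup>2 / 2)"
    proof -
      have "norm (G \<theta>) = exp (- (1 / 4) * (\<kappa> * \<theta>\<^sup>2)) * exp (- (\<kappa> / 2) * \<theta>\<^sup>2 / 2)"
        by (simp add: G_def norm_mult flip: exp_add)
      also have "\<dots> \<le> exp (- (1 / 4) * (m * \<theta>\<^sup>2)) * exp (- (\<kappa> / 2) * \<theta>\<^sup>2 / 2)"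
        using \<kappa> by (intro mult_right_mono) (auto intro: mult_right_mono)
      also have "\<dots> \<le> 1 / m * exp (- (\<kappa> / 2) * \<theta>\<^sup>2 / 2)"
        using False by (intro mult_right_mono small) auto
      finally show ?thesis .
    qed
    moreover have "norm (F \<theta> - G \<theta>) \<le> norm (F \<theta>) + norm (G \<theta>)" by (rule norm_triangle_ineq4)
    moreover have "0 \<le> 4 * \<theta>0 ^ 3 * \<kappa> * indicator {- \<theta>0..\<theta>0} \<theta>" using \<theta>0 \<kappa> by simp
    ultimately show ?thesis unfolding H_def by linarith
  qed
  have G_int: "integrable lborel G" using G by (simp add: has_bochner_integral_iff)
  have "norm (integral\<^sup>L lborel F - integral\<^sup>L lborel G) = norm (\<integral>\<theta>. F \<theta> - G \<theta> \<partial>lborel)"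
    using F_int G_int by simp
  also have "\<dots> \<le> (\<integral>\<theta>. norm (F \<theta> - G \<theta>) \<partial>lborel)" by (rule integral_norm_bound)
  also have "\<dots> \<le> integral\<^sup>L lborel H"
    using F_int G_int H_int bound by (intro integral_mono) auto
  \<comment> \<open>By \<kappa> \<le> 4m the central term 8 \<theta>0^4 \<kappa> becomes 32 L^4 / m;
    the tails add at most 4 pi / m < 16 / m.\<close>
  also have "\<dots> \<le> 32 * (L ^ 4 / m) + 16 / m"
  proof -
    have "4 * \<theta>0 ^ 3 * \<kappa> * (2 * \<theta>0) = 8 * (\<theta>0 ^ 4 * \<kappa>)"
      by (simp add: power4_eq_xxxx power3_eq_cube)
    also have "\<dots> \<le> 8 * (\<theta>0 ^ 4 * (4 * m))"
      using \<kappa> by (intro mult_left_mono) auto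
    also have "\<dots> = 32 * (L ^ 4 / m)"
      using m0 by (simp add: \<theta>04 power2_eq_square)
    finally have 1: "4 * \<theta>0 ^ 3 * \<kappa> * (2 * \<theta>0) \<le> 32 * (L ^ 4 / m)" .
    define S where "S = sqrt (2 * pi * (\<kappa> / 2))"
    have "1 * 1 \<le> pi * \<kappa>" using \<kappa> m1 pi_gt3 by (intro mult_mono) auto
    then have "S \<ge> 1" by (simp add: S_def)
    then have "2 * pi / S \<le> 2 * pi / 1"
      by (intro divide_left_mono) simp_all
    then have "2 * pi + 2 * pi / S \<le> 16"
      using pi_less_4 by linarith
    then have "1 / m * (2 * pi + 2 * pi / S) \<le> 1 / m * 16"
      using m0 by (intro mult_left_mono) auto
    then show ?thesis using 1 unfolding H_val distrib_left S_def by linarith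
  qed
  finally have norm_le: "norm (integral\<^sup>L lborel F - integral\<^sup>L lborel G) \<le> 32 * (L ^ 4 / m) + 16 / m" .
  define D where "D = \<bar>Re (integral\<^sup>L lborel F) - Re (integral\<^sup>L lborel G)\<bar>"
  have "1 / m \<le> L ^ 4 / m"
    using L m0 one_le_power[of L 4] by (intro divide_right_mono) auto
  \<comment> \<open>48 = 32 + 16, since L^4 \<ge> 1; the division by 2 pi is then simply
    dropped.\<close>
  then have "D \<le> 48 * (L ^ 4 / m)"
    using norm_le abs_Re_le_cmod[of "integral\<^sup>L lborel F - integral\<^sup>L lborel G"]
    unfolding D_def minus_complex.sel by linarith
  moreover have "D / (2 * pi) \<le> D / 1"
    using pi_gt3 by (intro divide_left_mono) (auto simp: D_def)
  ultimately have "D / (2 * pi) \<le> 48 * (1 / m) * L ^ 4" by simp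
  moreover have "\<bar>delta j t - 1 / sqrt (2 * pi * \<kappa>) * exp (- (of_int j)\<^sup>2 / (2 * \<kappa>))\<bar> = D / (2 * pi)"
    unfolding F_val G_val diff_divide_distrib[symmetric] abs_divide D_def by simp
  ultimately show ?thesis by (simp only: \<kappa>_def L_def)
qed

theorem theorem1p2:
  shows "\<exists>M0 C :: real. \<forall>t :: nat. \<forall>j :: int.
    t > 0 \<and> real (num_blocks t) > M0 \<longrightarrow>
    \<bar>delta j t - 1 / sqrt (2 * pi * kappa2 t) * exp (- ((real_of_int j) ^ 2) / (2 * kappa2 t))\<bar>
      \<le> C * (1 / real (num_blocks t)) * (ln (real (num_blocks t)))^4"
proof (intro exI allI impI)
  fix t j
  assume "t > 0 \<and> real (num_blocks t) > exp 96"
  then show "\<bar>delta j t - 1 / sqrt (2 * pi * kappa2 t) * exp (- ((real_of_int j) ^ 2) / (2 * kappa2 t))\<bar>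
      \<le> 48 * (1 / real (num_blocks t)) * (ln (real (num_blocks t)))^4"
    by (intro delta_gaussian_estimate) auto
qed

end
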